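(* Let $T$ and $S_s$ ($s>0$) be the bundle automorphisms of $\mathcal{S}^\bullet$ given by $T|_{\mathcal{B}^{p,q}}=(-1)^q\,\mathrm{id}$ and $S_s|_{\mathcal{B}^{p,q}}=s^q\,\mathrm{id}$. With respect to both weighted pairings $\langle\cdot,\cdot\rangle_{A,\lambda}$ and $\langle\cdot,\cdot\rangle_{B,\omega}$: 1. $T$ is unitary, i.e. $\langle Tu,Tv\rangle=\langle u,v\rangle$ on $\mathcal{S}^\bullet$. 2. $S_s$ is a bounded invertible operator with $$\|S_su\|^2=\sum_{p,q}\int_M s^{2q}\,\mathrm{wt}(x)\,\|u_{p,q}(x)\|_{p,q}^2\,dV_g,$$ where $\mathrm{wt}=w_\lambda$ (respectively $\mathrm{wt}=\kappa_\omega$) and $u=\sum u_{p,q}$ is the bigraded decomposition. Consequently, the Hilbert completions defined by $\langle\cdot,\cdot\rangle_{A,\lambda}$ and by $\langle\cdot,\cdot\rangle_{A,-\lambda}$ agree, and the same holds for the completions with $\langle\cdot,\cdot\rangle_{B,\omega}$.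
   Context: Setting: $M$ is a closed connected smooth manifold with Riemannian metric $g$ and volume form $dV_g$, $G$ a compact connected semisimple Lie group with Lie algebra $\mathfrak{g}$, $P\to M$ a principal $G$-bundle with smooth connection $\omega$ and curvature $F_\omega\in\Omega^2(M,\mathcal{G})$, where $\mathcal{G}=\mathrm{ad}P$; $\lambda\in\Gamma(\mathrm{ad}^*P)\cong\Gamma(\mathrm{ad}P)$ is a covariantly constant section. Put $\mathcal{B}^{p,q}=\Omega^p(M)\otimes\mathrm{Sym}^q(\mathcal{G})$ and $\mathcal{S}^\bullet=\bigoplus_{p+q=\bullet}\mathcal{B}^{p,q}$. Let $\langle\cdot,\cdot\rangle_{p,q}$ be the pointwise inner product on $\mathcal{B}^{p,q}$ induced by $g$ and the $\mathrm{Ad}$-invariant inner product on $\mathfrak{g}$ coming from the Killing form. Weights: $w_\lambda(x)=1+\|\lambda(x)\|^2$ and $\kappa_\omega(x)=1+\|F_\omega(x)\|^2$. Weighted pairings: $\langle u,v\rangle_{A,\lambda}=\int_Mw_\lambda(x)\langle u(x),v(x)\rangle_{p,q}\,dV_g$ and $\langle u,v\rangle_{B,\omega}=\int_M\kappa_\omega(x)\langle u(x),v(x)\rangle_{p,q}\,dV_g$ for $u,v\in\Gamma(\mathcal{B}^{p,q})$, extended to $\mathcal{S}^\bullet$ by orthogonal sum over $(p,q)$. *)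

theory Defs
  imports
    "HOL-Analysis.Analysis"
    "HOL-Algebra.Group"
    "HOL-Library.Function_Algebras"
    "HOL-Library.Multiset"
begin

instantiation "fun" :: (type, real_vector) real_vector
begin

definition scaleR_fun :: "real \<Rightarrow> ('a \<Rightarrow> 'b) \<Rightarrow> 'a \<Rightarrow> 'b"
  where "scaleR_fun c f = (\<lambda>x. c *\<^sub>R f x)"

instance
  by standard (auto simp: scaleR_fun_def plus_fun_def fun_eq_iff scaleR_add_right scaleR_add_left)

end


section \<open>Smooth manifolds\<close>

primrec Ck_on :: "nat \<Rightarrow> 'a::real_normed_vector set \<Rightarrow> ('a \<Rightarrow> 'b::real_normed_vector) \<Rightarrow> bool"
where
  "Ck_on 0 S f \<longleftrightarrow> continuous_on S f"
| "Ck_on (Suc k) S f \<longleftrightarrow>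
     (\<forall>x\<in>S. f differentiable (at x)) \<and> (\<forall>v. Ck_on k S (\<lambda>x. frechet_derivative f (at x) v))"

text \<open>Used only for open \<open>S\<close> in finite-dimensional spaces.\<close>
definition smooth_on :: "'a::real_normed_vector set \<Rightarrow> ('a \<Rightarrow> 'b::real_normed_vector) \<Rightarrow> bool"
  where "smooth_on S f \<longleftrightarrow> (\<forall>k. Ck_on k S f)"

type_synonym ('m, 'a) chart = "'m set \<times> ('m \<Rightarrow> 'a)"

abbreviation chart_inv :: "('m, 'a) chart \<Rightarrow> 'a \<Rightarrow> 'm"
  where "chart_inv c \<equiv> inv_into (fst c) (snd c)"

definition is_chart :: "('m::topological_space, 'a::euclidean_space) chart \<Rightarrow> bool"
  where "is_chart c \<longleftrightarrow> open (fst c) \<and> open (snd c ` fst c) \<and>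
    homeomorphism (fst c) (snd c ` fst c) (snd c) (chart_inv c)"

text \<open>A smooth structure on the whole (Hausdorff, second countable) space \<open>'m\<close>, without boundary,
  given by a smooth atlas that need not be maximal.\<close>
definition smooth_atlas ::
    "('m::{t2_space,second_countable_topology}, 'a::euclidean_space) chart set \<Rightarrow> bool"
  where "smooth_atlas A \<longleftrightarrow> (\<forall>c\<in>A. is_chart c) \<and> (\<Union>c\<in>A. fst c) = UNIV \<and>
    (\<forall>c\<in>A. \<forall>d\<in>A. smooth_on (snd c ` (fst c \<inter> fst d)) (snd d \<circ> chart_inv c))"

definition prod_atlas ::
    "('m, 'a) chart set \<Rightarrow> ('n, 'b) chart set \<Rightarrow> ('m \<times> 'n, 'a \<times> 'b) chart set"
  where "prod_atlas A B =
    {(fst c \<times> fst d, map_prod (snd c) (snd d)) | c d. c \<in> A \<and> d \<in> B}"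

definition std_atlas :: "('a, 'a) chart set"
  where "std_atlas = {(UNIV, id)}"

definition smooth_map_on ::
    "'m set \<Rightarrow> ('m::topological_space, 'a::euclidean_space) chart set \<Rightarrow>
     ('n::topological_space, 'b::euclidean_space) chart set \<Rightarrow> ('m \<Rightarrow> 'n) \<Rightarrow> bool"
  where "smooth_map_on W A B f \<longleftrightarrow> continuous_on W f \<and>
    (\<forall>c\<in>A. \<forall>d\<in>B. smooth_on (snd c ` (fst c \<inter> W \<inter> f -` fst d)) (snd d \<circ> f \<circ> chart_inv c))"

text \<open>Every point \<open>x\<close> gets one preferred chart of the atlas.  A tangent vector at \<open>x\<close> is written in the
  coordinates of that chart, so the tangent space at \<open>x\<close> is the model vector space.\<close>
definition chart_at :: "('m, 'a) chart set \<Rightarrow> 'm \<Rightarrow> ('m, 'a) chart"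
  where "chart_at A x = (SOME c. c \<in> A \<and> x \<in> fst c)"

definition tangent_map ::
    "('m, 'a::real_normed_vector) chart set \<Rightarrow> ('n, 'b::real_normed_vector) chart set \<Rightarrow>
     ('m \<Rightarrow> 'n) \<Rightarrow> 'm \<Rightarrow> 'a \<Rightarrow> 'b"
  where "tangent_map A B f x =
    frechet_derivative (snd (chart_at B (f x)) \<circ> f \<circ> chart_inv (chart_at A x))
      (at (snd (chart_at A x) x))"

text \<open>The tangent vector at \<open>x\<close> whose coordinates in the chart \<open>c\<close> are \<open>v\<close>; with \<open>v\<close> constant and \<open>x\<close>
  varying these are the coordinate vector fields of \<open>c\<close>.\<close>
definition coord_vec ::
    "('m, 'a::real_normed_vector) chart set \<Rightarrow> ('m, 'a) chart \<Rightarrow> 'm \<Rightarrow> 'a \<Rightarrow> 'a"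
  where "coord_vec A c x = frechet_derivative (snd (chart_at A x) \<circ> chart_inv c) (at (snd c x))"


section \<open>Riemannian metrics\<close>

definition inner_product_form :: "('a::real_vector \<Rightarrow> 'a \<Rightarrow> real) \<Rightarrow> bool"
  where "inner_product_form h \<longleftrightarrow>
    (\<forall>v. linear (h v)) \<and> (\<forall>v w. h v w = h w v) \<and> (\<forall>v. v \<noteq> 0 \<longrightarrow> h v v > 0)"

definition riemannian_metric ::
    "('m::topological_space, 'a::euclidean_space) chart set \<Rightarrow> ('m \<Rightarrow> 'a \<Rightarrow> 'a \<Rightarrow> real) \<Rightarrow> bool"
  where "riemannian_metric A g \<longleftrightarrow> (\<forall>x. inner_product_form (g x)) \<and>
    (\<forall>c\<in>A. \<forall>v w. smooth_map_on (fst c) A std_atlas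
       (\<lambda>x. g x (coord_vec A c x v) (coord_vec A c x w)))"

definition gram ::
    "('m, real^'n) chart set \<Rightarrow> ('m \<Rightarrow> real^'n \<Rightarrow> real^'n \<Rightarrow> real) \<Rightarrow>
     ('m, real^'n) chart \<Rightarrow> 'm \<Rightarrow> real^'n^'n"
  where "gram A g c x =
    (\<chi> i j. g x (coord_vec A c x (axis i 1)) (coord_vec A c x (axis j 1)))"

text \<open>The measure \<open>dV\<^sub>g\<close>: in every chart it has density \<open>sqrt (det g\<^sub>i\<^sub>j)\<close>.  No orientation is needed;
  on an oriented manifold this is integration against the volume form.\<close>
definition riemannian_measure ::
    "('m::topological_space, real^'n) chart set \<Rightarrow> ('m \<Rightarrow> real^'n \<Rightarrow> real^'n \<Rightarrow> real) \<Rightarrow> 'm measure"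
  where "riemannian_measure A g = (THE \<mu>. sets \<mu> = sets borel \<and>
    (\<forall>c\<in>A. \<forall>E\<in>sets borel. E \<subseteq> fst c \<longrightarrow>
       emeasure \<mu> E =
         (\<integral>\<^sup>+ y \<in> snd c ` E. ennreal (sqrt (det (gram A g c (chart_inv c y)))) \<partial>lborel)))"


section \<open>Lie groups\<close>

definition lie_group ::
    "'g monoid \<Rightarrow> ('g::{t2_space,second_countable_topology}, 'a::euclidean_space) chart set \<Rightarrow> bool"
  where "lie_group G A \<longleftrightarrow> Group.group G \<and> carrier G = UNIV \<and> smooth_atlas A \<and>
    smooth_map_on UNIV (prod_atlas A A) A (\<lambda>(a, b). a \<otimes>\<^bsub>G\<^esub> b) \<and>
    smooth_map_on UNIV A A (m_inv G)"

text \<open>The Lie algebra is the tangent space at the unit.  \<open>Ad a\<close> is the derivative of conjugation by \<open>a\<close>,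
  and the bracket is \<open>[X, Y] = (d Ad) X Y\<close>.\<close>
definition Ad ::
    "'g monoid \<Rightarrow> ('g, 'a::real_normed_vector) chart set \<Rightarrow> 'g \<Rightarrow> 'a \<Rightarrow> 'a"
  where "Ad G A a = tangent_map A A (\<lambda>b. a \<otimes>\<^bsub>G\<^esub> b \<otimes>\<^bsub>G\<^esub> m_inv G a) \<one>\<^bsub>G\<^esub>"

definition lie_bracket ::
    "'g monoid \<Rightarrow> ('g, 'a::real_normed_vector) chart set \<Rightarrow> 'a \<Rightarrow> 'a \<Rightarrow> 'a"
  where "lie_bracket G A X Y = tangent_map A std_atlas (\<lambda>a. Ad G A a Y) \<one>\<^bsub>G\<^esub> X"

definition lie_ideal :: "('a::real_vector \<Rightarrow> 'a \<Rightarrow> 'a) \<Rightarrow> 'a set \<Rightarrow> bool"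
  where "lie_ideal br I \<longleftrightarrow> subspace I \<and> (\<forall>X. \<forall>Y\<in>I. br X Y \<in> I)"

primrec derived_series :: "('a::real_vector \<Rightarrow> 'a \<Rightarrow> 'a) \<Rightarrow> 'a set \<Rightarrow> nat \<Rightarrow> 'a set"
where
  "derived_series br I 0 = I"
| "derived_series br I (Suc k) =
     span {br X Y | X Y. X \<in> derived_series br I k \<and> Y \<in> derived_series br I k}"

definition semisimple :: "('a::real_vector \<Rightarrow> 'a \<Rightarrow> 'a) \<Rightarrow> bool"
  where "semisimple br \<longleftrightarrow>
    (\<forall>I. lie_ideal br I \<and> (\<exists>k. derived_series br I k = {0}) \<longrightarrow> I = {0})"

definition killing_form :: "(real^'k \<Rightarrow> real^'k \<Rightarrow> real^'k) \<Rightarrow> real^'k \<Rightarrow> real^'k \<Rightarrow> real"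
  where "killing_form br X Y = trace (matrix (br X \<circ> br Y))"


section \<open>Principal bundles with connection\<close>

text \<open>\<open>\<lambda>\<close> is a section of \<open>ad P\<close>: a point \<open>x\<close> is sent to an element of the fibre of \<open>ad P\<close> over \<open>x\<close>,
  which is an equivariant map from the fibre of \<open>P\<close> to the Lie algebra.\<close>
record ('m, 'g, 'p, 'n::finite, 'k::finite) gauge_data =
  M_atlas :: "('m, real^'n) chart set"
  M_metric :: "'m \<Rightarrow> real^'n \<Rightarrow> real^'n \<Rightarrow> real"
  G_group :: "'g monoid"
  G_atlas :: "('g, real^'k) chart set"
  P_atlas :: "('p, (real^'n) \<times> (real^'k)) chart set"
  P_proj :: "'p \<Rightarrow> 'm"
  P_act :: "'p \<Rightarrow> 'g \<Rightarrow> 'p"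
  P_conn :: "'p \<Rightarrow> (real^'n) \<times> (real^'k) \<Rightarrow> real^'k"
  P_lam :: "'m \<Rightarrow> 'p \<Rightarrow> real^'k"

abbreviation gAd :: "('m, 'g, 'p, 'n::finite, 'k::finite) gauge_data \<Rightarrow> 'g \<Rightarrow> real^'k \<Rightarrow> real^'k"
  where "gAd D \<equiv> Ad (G_group D) (G_atlas D)"

abbreviation gbr ::
    "('m, 'g, 'p, 'n::finite, 'k::finite) gauge_data \<Rightarrow> real^'k \<Rightarrow> real^'k \<Rightarrow> real^'k"
  where "gbr D \<equiv> lie_bracket (G_group D) (G_atlas D)"

text \<open>For compact semisimple \<open>G\<close> the Killing form is negative definite and \<open>Ad\<close>-invariant.\<close>
definition lie_inner ::
    "('m, 'g, 'p, 'n::finite, 'k::finite) gauge_data \<Rightarrow> real^'k \<Rightarrow> real^'k \<Rightarrow> real"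
  where "lie_inner D X Y = - killing_form (gbr D) X Y"

definition principal_bundle ::
    "('m::{t2_space,second_countable_topology}, 'g::{t2_space,second_countable_topology},
      'p::{t2_space,second_countable_topology}, 'n::finite, 'k::finite) gauge_data \<Rightarrow> bool"
  where "principal_bundle D \<longleftrightarrow> smooth_atlas (P_atlas D) \<and>
    smooth_map_on UNIV (P_atlas D) (M_atlas D) (P_proj D) \<and>
    smooth_map_on UNIV (prod_atlas (P_atlas D) (G_atlas D)) (P_atlas D) (\<lambda>(r, a). P_act D r a) \<and>
    (\<forall>r. P_act D r \<one>\<^bsub>G_group D\<^esub> = r) \<and>
    (\<forall>r a. P_proj D (P_act D r a) = P_proj D r) \<and>
    (\<forall>r a b. P_act D (P_act D r a) b = P_act D r (a \<otimes>\<^bsub>G_group D\<^esub> b)) \<and>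
    (\<forall>x. \<exists>U \<Phi> \<Psi>. open U \<and> x \<in> U \<and>
       homeomorphism (P_proj D -` U) (U \<times> UNIV) \<Phi> \<Psi> \<and>
       smooth_map_on (P_proj D -` U) (P_atlas D) (prod_atlas (M_atlas D) (G_atlas D)) \<Phi> \<and>
       smooth_map_on (U \<times> UNIV) (prod_atlas (M_atlas D) (G_atlas D)) (P_atlas D) \<Psi> \<and>
       (\<forall>r. P_proj D r \<in> U \<longrightarrow> fst (\<Phi> r) = P_proj D r \<and>
          (\<forall>a. \<Phi> (P_act D r a) = (P_proj D r, snd (\<Phi> r) \<otimes>\<^bsub>G_group D\<^esub> a))))"

definition principal_connection ::
    "('m, 'g, 'p::topological_space, 'n::finite, 'k::finite) gauge_data \<Rightarrow> bool"
  where "principal_connection D \<longleftrightarrow>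
    (\<forall>r. linear (P_conn D r)) \<and>
    (\<forall>c\<in>P_atlas D. \<forall>v. smooth_map_on (fst c) (P_atlas D) std_atlas
       (\<lambda>r. P_conn D r (coord_vec (P_atlas D) c r v))) \<and>
    (\<forall>r X. P_conn D r (tangent_map (G_atlas D) (P_atlas D) (P_act D r) \<one>\<^bsub>G_group D\<^esub> X) = X) \<and>
    (\<forall>r a v. P_conn D (P_act D r a)
         (tangent_map (P_atlas D) (P_atlas D) (\<lambda>s. P_act D s a) r v) =
       gAd D (m_inv (G_group D) a) (P_conn D r v))"

text \<open>\<open>d\<omega> + 1/2 [\<omega> \<and> \<omega>]\<close> on \<open>P\<close>; at \<open>r\<close> the exterior derivative is computed with the coordinate vector
  fields of the preferred chart at \<open>r\<close>, which commute and extend the given tangent vectors.\<close>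
definition conn_ext_deriv ::
    "('m, 'g, 'p, 'n::finite, 'k::finite) gauge_data \<Rightarrow> 'p \<Rightarrow>
     (real^'n) \<times> (real^'k) \<Rightarrow> (real^'n) \<times> (real^'k) \<Rightarrow> real^'k"
  where "conn_ext_deriv D r v w =
    (let A = P_atlas D; c = chart_at A r in
       tangent_map A std_atlas (\<lambda>s. P_conn D s (coord_vec A c s w)) r v -
       tangent_map A std_atlas (\<lambda>s. P_conn D s (coord_vec A c s v)) r w)"

definition curvature_on_P ::
    "('m, 'g, 'p, 'n::finite, 'k::finite) gauge_data \<Rightarrow> 'p \<Rightarrow>
     (real^'n) \<times> (real^'k) \<Rightarrow> (real^'n) \<times> (real^'k) \<Rightarrow> real^'k"
  where "curvature_on_P D r v w =
    conn_ext_deriv D r v w + gbr D (P_conn D r v) (P_conn D r w)"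

definition horizontal_lift ::
    "('m, 'g, 'p, 'n::finite, 'k::finite) gauge_data \<Rightarrow> 'p \<Rightarrow> real^'n \<Rightarrow> (real^'n) \<times> (real^'k)"
  where "horizontal_lift D r X =
    (THE v. tangent_map (P_atlas D) (M_atlas D) (P_proj D) r v = X \<and> P_conn D r v = 0)"

definition adjoint_section ::
    "('m, 'g, 'p::topological_space, 'n::finite, 'k::finite) gauge_data \<Rightarrow>
     ('m \<Rightarrow> 'p \<Rightarrow> real^'k) \<Rightarrow> bool"
  where "adjoint_section D \<sigma> \<longleftrightarrow>
    (\<forall>x r. P_proj D r \<noteq> x \<longrightarrow> \<sigma> x r = 0) \<and>
    (\<forall>x r a. P_proj D r = x \<longrightarrow>
       \<sigma> x (P_act D r a) = gAd D (m_inv (G_group D) a) (\<sigma> x r)) \<and>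
    smooth_map_on UNIV (P_atlas D) std_atlas (\<lambda>r. \<sigma> (P_proj D r) r)"

definition covariantly_constant ::
    "('m, 'g, 'p, 'n::finite, 'k::finite) gauge_data \<Rightarrow> ('m \<Rightarrow> 'p \<Rightarrow> real^'k) \<Rightarrow> bool"
  where "covariantly_constant D \<sigma> \<longleftrightarrow>
    (\<forall>r X. tangent_map (P_atlas D) std_atlas (\<lambda>s. \<sigma> (P_proj D s) s) r (horizontal_lift D r X) = 0)"

definition gauge_setting ::
    "('m::{t2_space,second_countable_topology}, 'g::{t2_space,second_countable_topology},
      'p::{t2_space,second_countable_topology}, 'n::finite, 'k::finite) gauge_data \<Rightarrow> bool"
  where "gauge_setting D \<longleftrightarrow>
    smooth_atlas (M_atlas D) \<and> compact (UNIV :: 'm set) \<and> connected (UNIV :: 'm set) \<and>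
    riemannian_metric (M_atlas D) (M_metric D) \<and>
    lie_group (G_group D) (G_atlas D) \<and> compact (UNIV :: 'g set) \<and> connected (UNIV :: 'g set) \<and>
    semisimple (gbr D) \<and>
    principal_bundle D \<and> principal_connection D \<and>
    adjoint_section D (P_lam D) \<and> covariantly_constant D (P_lam D)"


section \<open>The bundles \<open>B\<^sup>p\<^sup>,\<^sup>q\<close> and \<open>S\<^sup>n\<close>\<close>

text \<open>\<open>\<Lambda>\<^sup>p(T\<^sub>x\<^sup>*M) \<otimes> Sym\<^sup>q(\<gg>)\<close>, realised by multilinear maps of \<open>p\<close> tangent vectors (alternating) and \<open>q\<close>
  covectors on the Lie algebra (symmetric).  An element is extended by zero to lists of any other
  length.\<close>
type_synonym ('n, 'k) bitensor = "(real^'n) list \<Rightarrow> ((real^'k) \<Rightarrow>\<^sub>L real) list \<Rightarrow> real"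

definition bitensors :: "nat \<Rightarrow> nat \<Rightarrow> ('n::finite, 'k::finite) bitensor set"
  where "bitensors p q = {\<alpha>.
    (\<forall>l m. length l \<noteq> p \<or> length m \<noteq> q \<longrightarrow> \<alpha> l m = 0) \<and>
    (\<forall>l m i. length l = p \<and> length m = q \<and> i < p \<longrightarrow> linear (\<lambda>v. \<alpha> (l[i := v]) m)) \<and>
    (\<forall>l m i. length l = p \<and> length m = q \<and> i < q \<longrightarrow> linear (\<lambda>\<phi>. \<alpha> l (m[i := \<phi>]))) \<and>
    (\<forall>l m i j. length l = p \<and> length m = q \<and> i < j \<and> j < p \<and> l ! i = l ! j \<longrightarrow> \<alpha> l m = 0) \<and>
    (\<forall>l m m'. mset m = mset m' \<longrightarrow> \<alpha> l m = \<alpha> l m')}"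

text \<open>The action on \<open>Sym\<^sup>q(\<gg>)\<close> induced by \<open>Ad\<close>; on a covector it is composition with \<open>Ad a\<close>.\<close>
definition bitensor_Ad ::
    "('m, 'g, 'p, 'n::finite, 'k::finite) gauge_data \<Rightarrow> 'g \<Rightarrow>
     ('n, 'k) bitensor \<Rightarrow> ('n, 'k) bitensor"
  where "bitensor_Ad D a \<alpha> = (\<lambda>l m. \<alpha> l (map (\<lambda>\<phi>. \<phi> o\<^sub>L Blinfun (gAd D a)) m))"

text \<open>The fibre over \<open>x\<close> of the associated bundle is the space of equivariant maps from the fibre of
  \<open>P\<close> over \<open>x\<close> (extended by zero to the rest of \<open>P\<close>).\<close>
definition B_fibre ::
    "('m, 'g, 'p, 'n::finite, 'k::finite) gauge_data \<Rightarrow> nat \<Rightarrow> nat \<Rightarrow> 'm \<Rightarrow>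
     ('p \<Rightarrow> ('n, 'k) bitensor) set"
  where "B_fibre D p q x = {\<xi>.
    (\<forall>r. P_proj D r \<noteq> x \<longrightarrow> \<xi> r = 0) \<and>
    (\<forall>r. P_proj D r = x \<longrightarrow> \<xi> r \<in> bitensors p q) \<and>
    (\<forall>r a. P_proj D r = x \<longrightarrow> \<xi> (P_act D r a) = bitensor_Ad D (m_inv (G_group D) a) (\<xi> r))}"

definition B_smooth ::
    "('m::topological_space, 'g, 'p::topological_space, 'n::finite, 'k::finite) gauge_data \<Rightarrow>
     ('m \<Rightarrow> 'p \<Rightarrow> ('n, 'k) bitensor) \<Rightarrow> bool"
  where "B_smooth D u \<longleftrightarrow> (\<forall>c\<in>M_atlas D. \<forall>l m.
    smooth_map_on (P_proj D -` fst c) (P_atlas D) std_atlas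
      (\<lambda>r. u (P_proj D r) r (map (coord_vec (M_atlas D) c (P_proj D r)) l) m))"

definition orthonormal_frame :: "(real^'i \<Rightarrow> real^'i \<Rightarrow> real) \<Rightarrow> 'i::finite \<Rightarrow> real^'i"
  where "orthonormal_frame h = (SOME e. \<forall>i j. h (e i) (e j) = (if i = j then 1 else 0))"

text \<open>The inner product induced on \<open>\<Lambda>\<^sup>p(T\<^sub>x\<^sup>*M) \<otimes> Sym\<^sup>q(\<gg>)\<close>, via orthonormal frames of the tangent space
  and of the Lie algebra.  Increasing wedge products of an orthonormal coframe are orthonormal, whence
  the factor \<open>1/p!\<close>; \<open>Sym\<^sup>q\<close> carries the restriction of the tensor power inner product.  The value does
  not depend on the frames, nor on the point \<open>r\<close> of the fibre of \<open>P\<close>.\<close>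
definition B_inner ::
    "('m, 'g, 'p, 'n::finite, 'k::finite) gauge_data \<Rightarrow> nat \<Rightarrow> nat \<Rightarrow> 'm \<Rightarrow>
     ('p \<Rightarrow> ('n, 'k) bitensor) \<Rightarrow> ('p \<Rightarrow> ('n, 'k) bitensor) \<Rightarrow> real"
  where "B_inner D p q x \<xi> \<eta> =
    (let r = (SOME r. P_proj D r = x);
         e = orthonormal_frame (M_metric D x);
         f = orthonormal_frame (lie_inner D);
         f' = (\<lambda>j. Blinfun (lie_inner D (f j)))
     in (1 / fact p) * (\<Sum>I | length I = p. \<Sum>J | length J = q.
          \<xi> r (map e I) (map f' J) * \<eta> r (map e I) (map f' J)))"

definition B_norm ::
    "('m, 'g, 'p, 'n::finite, 'k::finite) gauge_data \<Rightarrow> nat \<Rightarrow> nat \<Rightarrow> 'm \<Rightarrow>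
     ('p \<Rightarrow> ('n, 'k) bitensor) \<Rightarrow> real"
  where "B_norm D p q x \<xi> = sqrt (B_inner D p q x \<xi> \<xi>)"

text \<open>A Lie algebra valued \<open>p\<close>-form as an element of \<open>\<Lambda>\<^sup>p \<otimes> Sym\<^sup>1(\<gg>)\<close>.\<close>
definition ad_form :: "nat \<Rightarrow> ((real^'n) list \<Rightarrow> real^'k) \<Rightarrow> ('n::finite, 'k::finite) bitensor"
  where "ad_form p \<alpha> = (\<lambda>l m.
    if length l = p \<and> length m = 1 then blinfun_apply (m ! 0) (\<alpha> l) else 0)"

text \<open>The curvature as a two-form on \<open>M\<close> with values in \<open>ad P\<close>, i.e. a section of \<open>B\<^sup>2\<^sup>,\<^sup>1\<close>, and \<open>\<lambda>\<close> as a
  section of \<open>B\<^sup>0\<^sup>,\<^sup>1\<close>.\<close>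
definition curvature ::
    "('m, 'g, 'p, 'n::finite, 'k::finite) gauge_data \<Rightarrow> 'm \<Rightarrow> 'p \<Rightarrow> ('n, 'k) bitensor"
  where "curvature D x r = (if P_proj D r = x
    then ad_form 2 (\<lambda>l. curvature_on_P D r
           (horizontal_lift D r (l ! 0)) (horizontal_lift D r (l ! 1)))
    else 0)"

definition lam_B ::
    "('m, 'g, 'p, 'n::finite, 'k::finite) gauge_data \<Rightarrow> 'm \<Rightarrow> 'p \<Rightarrow> ('n, 'k) bitensor"
  where "lam_B D x r = ad_form 0 (\<lambda>_. P_lam D x r)"

definition weight_A :: "('m, 'g, 'p, 'n::finite, 'k::finite) gauge_data \<Rightarrow> 'm \<Rightarrow> real"
  where "weight_A D x = 1 + (B_norm D 0 1 x (lam_B D x))\<^sup>2"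

definition weight_B :: "('m, 'g, 'p, 'n::finite, 'k::finite) gauge_data \<Rightarrow> 'm \<Rightarrow> real"
  where "weight_B D x = 1 + (B_norm D 2 1 x (curvature D x))\<^sup>2"

text \<open>An element of the fibre of \<open>S\<^sup>n\<close> is the family of its components in the \<open>B\<^sup>p\<^sup>,\<^sup>q\<close> with \<open>p + q = n\<close>.\<close>
type_synonym ('p, 'n, 'k) S_elem = "nat \<Rightarrow> nat \<Rightarrow> 'p \<Rightarrow> ('n, 'k) bitensor"

definition S_fibre ::
    "('m, 'g, 'p, 'n::finite, 'k::finite) gauge_data \<Rightarrow> nat \<Rightarrow> 'm \<Rightarrow> ('p, 'n, 'k) S_elem set"
  where "S_fibre D n x =
    {\<sigma>. \<forall>p q. if p + q = n then \<sigma> p q \<in> B_fibre D p q x else \<sigma> p q = 0}"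

definition S_sections ::
    "('m::topological_space, 'g, 'p::topological_space, 'n::finite, 'k::finite) gauge_data \<Rightarrow> nat \<Rightarrow>
     ('m \<Rightarrow> ('p, 'n, 'k) S_elem) set"
  where "S_sections D n =
    {u. (\<forall>x. u x \<in> S_fibre D n x) \<and> (\<forall>p q. B_smooth D (\<lambda>x. u x p q))}"

definition weighted_pairing ::
    "('m::topological_space, 'g, 'p, 'n::finite, 'k::finite) gauge_data \<Rightarrow> ('m \<Rightarrow> real) \<Rightarrow> nat \<Rightarrow>
     ('m \<Rightarrow> ('p, 'n, 'k) S_elem) \<Rightarrow> ('m \<Rightarrow> ('p, 'n, 'k) S_elem) \<Rightarrow> real"
  where "weighted_pairing D wt n u v = (\<Sum>(p, q) | p + q = n.
    \<integral>x. wt x * B_inner D p q x (u x p q) (v x p q) \<partial>riemannian_measure (M_atlas D) (M_metric D))"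

definition pairing_A where "pairing_A D = weighted_pairing D (weight_A D)"
definition pairing_B where "pairing_B D = weighted_pairing D (weight_B D)"

definition T_aut :: "('p, 'n::finite, 'k::finite) S_elem \<Rightarrow> ('p, 'n, 'k) S_elem"
  where "T_aut \<sigma> = (\<lambda>p q. (-1) ^ q *\<^sub>R \<sigma> p q)"

definition S_aut :: "real \<Rightarrow> ('p, 'n::finite, 'k::finite) S_elem \<Rightarrow> ('p, 'n, 'k) S_elem"
  where "S_aut s \<sigma> = (\<lambda>p q. s ^ q *\<^sub>R \<sigma> p q)"

definition flip_lam ::
    "('m, 'g, 'p, 'n::finite, 'k::finite) gauge_data \<Rightarrow> ('m, 'g, 'p, 'n, 'k) gauge_data"
  where "flip_lam D = D\<lparr>P_lam := - P_lam D\<rparr>"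


section \<open>Operators on pre-Hilbert spaces and Hilbert completions\<close>

definition pnorm :: "('v \<Rightarrow> 'v \<Rightarrow> real) \<Rightarrow> 'v \<Rightarrow> real"
  where "pnorm ip u = sqrt (ip u u)"

definition linear_bij_on :: "'v::real_vector set \<Rightarrow> ('v \<Rightarrow> 'v) \<Rightarrow> bool"
  where "linear_bij_on V L \<longleftrightarrow> bij_betw L V V \<and>
    (\<forall>u\<in>V. \<forall>v\<in>V. \<forall>a b. L (a *\<^sub>R u + b *\<^sub>R v) = a *\<^sub>R L u + b *\<^sub>R L v)"

definition unitary_on :: "'v::real_vector set \<Rightarrow> ('v \<Rightarrow> 'v \<Rightarrow> real) \<Rightarrow> ('v \<Rightarrow> 'v) \<Rightarrow> bool"
  where "unitary_on V ip L \<longleftrightarrow> linear_bij_on V L \<and> (\<forall>u\<in>V. \<forall>v\<in>V. ip (L u) (L v) = ip u v)"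

definition bounded_invertible_on ::
    "'v::real_vector set \<Rightarrow> ('v \<Rightarrow> 'v \<Rightarrow> real) \<Rightarrow> ('v \<Rightarrow> 'v) \<Rightarrow> bool"
  where "bounded_invertible_on V ip L \<longleftrightarrow> linear_bij_on V L \<and>
    (\<exists>C. \<forall>u\<in>V. pnorm ip (L u) \<le> C * pnorm ip u) \<and>
    (\<exists>C. \<forall>u\<in>V. pnorm ip (inv_into V L u) \<le> C * pnorm ip u)"

text \<open>The Hilbert completion of a pre-Hilbert space \<open>(V, ip)\<close>: Cauchy sequences modulo null sequences,
  with the induced operations and the canonical map from \<open>V\<close>.\<close>
definition cauchy_seqs :: "'v::real_vector set \<Rightarrow> ('v \<Rightarrow> 'v \<Rightarrow> real) \<Rightarrow> (nat \<Rightarrow> 'v) set"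
  where "cauchy_seqs V ip = {X. (\<forall>k. X k \<in> V) \<and>
    (\<forall>\<epsilon>>0. \<exists>N. \<forall>j\<ge>N. \<forall>k\<ge>N. pnorm ip (X j - X k) < \<epsilon>)}"

definition null_rel ::
    "'v::real_vector set \<Rightarrow> ('v \<Rightarrow> 'v \<Rightarrow> real) \<Rightarrow> ((nat \<Rightarrow> 'v) \<times> (nat \<Rightarrow> 'v)) set"
  where "null_rel V ip = {(X, Y). X \<in> cauchy_seqs V ip \<and> Y \<in> cauchy_seqs V ip \<and>
    (\<lambda>k. pnorm ip (X k - Y k)) \<longlonglongrightarrow> 0}"

record 'v hilbert_space =
  hcarrier :: "(nat \<Rightarrow> 'v) set set"
  hadd :: "(nat \<Rightarrow> 'v) set \<Rightarrow> (nat \<Rightarrow> 'v) set \<Rightarrow> (nat \<Rightarrow> 'v) set"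
  hscale :: "real \<Rightarrow> (nat \<Rightarrow> 'v) set \<Rightarrow> (nat \<Rightarrow> 'v) set"
  hinner :: "(nat \<Rightarrow> 'v) set \<Rightarrow> (nat \<Rightarrow> 'v) set \<Rightarrow> real"
  hembed :: "'v \<Rightarrow> (nat \<Rightarrow> 'v) set"

definition hilbert_completion ::
    "'v::real_vector set \<Rightarrow> ('v \<Rightarrow> 'v \<Rightarrow> real) \<Rightarrow> 'v hilbert_space"
  where "hilbert_completion V ip = \<lparr>
    hcarrier = cauchy_seqs V ip // null_rel V ip,
    hadd = (\<lambda>\<xi> \<eta>. \<Union>X\<in>\<xi>. \<Union>Y\<in>\<eta>. null_rel V ip `` {\<lambda>k. X k + Y k}),
    hscale = (\<lambda>a \<xi>. \<Union>X\<in>\<xi>. null_rel V ip `` {\<lambda>k. a *\<^sub>R X k}),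
    hinner = (\<lambda>\<xi> \<eta>. THE t. \<forall>X\<in>\<xi>. \<forall>Y\<in>\<eta>. (\<lambda>k. ip (X k) (Y k)) \<longlonglongrightarrow> t),
    hembed = (\<lambda>u. null_rel V ip `` {\<lambda>k. u})\<rparr>"

end

theory Submission
  imports Defs
begin

text \<open>\<open>T\<close> and \<open>S_s\<close> are both diagonal for the bigrading: each
  multiplies the component in \<B>^{p,q} by a constant \<open>c q\<close>, with
  \<open>c q = (-1)^q\<close> or \<open>c q = s^q\<close>. All claims are therefore proved for the
  operator \<open>deg_scale c\<close> with arbitrary coefficients \<open>c\<close>.

  By bilinearity of the pointwise inner product, applying \<open>deg_scale c\<close> and
  \<open>deg_scale d\<close> to the two arguments multiplies the (p,q) summand of the pairing by
  \<open>c q * d q\<close> (\<open>weighted_pairing_deg_scale\<close>). If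
  \<open>c q * c q = 1\<close>, the pairing is preserved. If no \<open>c q\<close> vanishes, the
  reciprocal coefficients give the inverse, and since p + q = n leaves only the degrees q \<le> n,
  both operators are bounded by a maximum of finitely many numbers
  (\<open>pnorm_deg_scale_le\<close>). The weight enters these estimates only through its
  nonnegativity. The analytic point is that these operators preserve smooth sections
  (\<open>B_smooth_scaleR\<close>).

  For the completions, the sign of \<lambda> can enter only through \<open>weight_A\<close>, which
  contains the squared norm of \<lambda>. Spaces and pairings for \<lambda> and -\<lambda> are thus
  equal, and so are the completions built from them.\<close>

section \<open>Constant multiples of smooth functions\<close>

lemma Ck_on_cong:
  assumes "open S" "\<And>x. x \<in> S \<Longrightarrow> f x = g x" "Ck_on k S f"
  shows "Ck_on k S g"
  using assms(2,3)
proof (induction k arbitrary: f g)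
  case 0
  then show ?case using continuous_on_cong[of S S f g] by simp
next
  case (Suc k)
  have deriv: "(g has_derivative frechet_derivative f (at x)) (at x)" if "x \<in> S" for x
  proof (rule has_derivative_transform_within_open[OF _ assms(1) that])
    show "(f has_derivative frechet_derivative f (at x)) (at x)"
      using Suc.prems(2) that by (simp add: frechet_derivative_works)
  qed (rule Suc.prems(1))
  have "Ck_on k S (\<lambda>x. frechet_derivative g (at x) v)" for v
  proof (rule Suc.IH)
    show "frechet_derivative f (at x) v = frechet_derivative g (at x) v" if "x \<in> S" for x
      using frechet_derivative_at[OF deriv[OF that]] by simp
  qed (use Suc.prems(2) in simp)
  moreover have "g differentiable (at x)" if "x \<in> S" for x
    using deriv[OF that] by (rule differentiableI)
  ultimately show ?case by simp
qed

lemma Ck_on_scaleR: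
  assumes "open S" "Ck_on k S f"
  shows "Ck_on k S (\<lambda>x. c *\<^sub>R f x)"
  using assms(2)
proof (induction k arbitrary: f)
  case 0
  then show ?case by (simp add: continuous_on_scaleR)
next
  case (Suc k)
  have deriv: "((\<lambda>x. c *\<^sub>R f x) has_derivative (\<lambda>v. c *\<^sub>R frechet_derivative f (at x) v)) (at x)"
    if "x \<in> S" for x
    using Suc.prems that by (intro has_derivative_scaleR_right) (simp add: frechet_derivative_works)
  have "Ck_on k S (\<lambda>x. frechet_derivative (\<lambda>y. c *\<^sub>R f y) (at x) v)" for v
  \<comment> \<open>The derivative of the multiple is known only at points of \<open>S\<close>,
    where \<open>f\<close> is differentiable; hence the passage through agreement on
    \<open>S\<close>.\<close>
  proof (rule Ck_on_cong[OF assms(1)])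
    show "Ck_on k S (\<lambda>x. c *\<^sub>R frechet_derivative f (at x) v)"
      using Suc by simp
    show "c *\<^sub>R frechet_derivative f (at x) v = frechet_derivative (\<lambda>y. c *\<^sub>R f y) (at x) v"
      if "x \<in> S" for x
      using fun_cong[OF frechet_derivative_at[OF deriv[OF that]]] .
  qed
  moreover have "(\<lambda>x. c *\<^sub>R f x) differentiable (at x)" if "x \<in> S" for x
    using deriv[OF that] by (rule differentiableI)
  ultimately show ?case by simp
qed

text \<open>Supplies the open coordinate domains on which \<open>Ck_on_scaleR\<close>
  applies.\<close>

lemma is_chart_open_image:
  assumes "is_chart c" "open W"
  shows "open (snd c ` (fst c \<inter> W))"
proof -
  from assms(1) have o: "open (snd c ` fst c)"
    and h: "homeomorphism (fst c) (snd c ` fst c) (snd c) (chart_inv c)"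
    by (auto simp: is_chart_def)
  have "openin (top_of_set (snd c ` fst c)) (snd c ` (fst c \<inter> W))"
    using homeomorphism_imp_open_map[OF h] assms(2) by blast
  with o show ?thesis by (simp add: openin_open_eq)
qed

lemma smooth_map_on_scaleR:
  fixes f :: "'m::{t2_space,second_countable_topology} \<Rightarrow> 'b::euclidean_space"
  assumes "smooth_atlas A" "open W" "smooth_map_on W A std_atlas f"
  shows "smooth_map_on W A std_atlas (\<lambda>x. c *\<^sub>R f x)"
proof -
  \<comment> \<open>The only chart of \<open>std_atlas\<close> is the identity on the whole space,
    so the target imposes no restriction on the coordinate domain.\<close>
  have "smooth_on (snd d ` (fst d \<inter> W)) ((\<lambda>x. c *\<^sub>R f x) \<circ> chart_inv d)" if "d \<in> A" for d
  proof -
    have "open (snd d ` (fst d \<inter> W))"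
      using assms(1,2) that by (auto simp: smooth_atlas_def intro: is_chart_open_image)
    moreover have "smooth_on (snd d ` (fst d \<inter> W)) (f \<circ> chart_inv d)"
      using assms(3) that by (auto simp: smooth_map_on_def std_atlas_def)
    ultimately show ?thesis
      by (auto simp: smooth_on_def o_def intro: Ck_on_scaleR)
  qed
  then show ?thesis
    using assms(3) by (auto simp: smooth_map_on_def std_atlas_def intro: continuous_on_scaleR)
qed

section \<open>Constant multiples in the fibres and of smooth sections\<close>

lemma bitensors_scaleR:
  assumes "\<alpha> \<in> bitensors p q"
  shows "c *\<^sub>R \<alpha> \<in> bitensors p q"
proof -
  have lin: "linear (\<lambda>v. c * f v)" if "linear f" for f :: "'c::real_vector \<Rightarrow> real"
    using linear_compose_scale_right[OF that] by simp
  have scale: "(c *\<^sub>R \<alpha>) l m = c * \<alpha> l m" for l m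
    by (simp add: scaleR_fun_def)
  note \<alpha> = assms[unfolded bitensors_def mem_Collect_eq]
  note \<alpha>2 = conjunct2[OF \<alpha>]
  note \<alpha>3 = conjunct2[OF \<alpha>2]
  note \<alpha>4 = conjunct2[OF \<alpha>3]
  show ?thesis
    unfolding bitensors_def mem_Collect_eq scale
  proof (intro conjI)
    show "\<forall>l m. length l \<noteq> p \<or> length m \<noteq> q \<longrightarrow> c * \<alpha> l m = 0"
      using conjunct1[OF \<alpha>] by simp
    show "\<forall>l m i. length l = p \<and> length m = q \<and> i < p \<longrightarrow> linear (\<lambda>v. c * \<alpha> (l[i := v]) m)"
      by (intro allI impI lin) (rule conjunct1[OF \<alpha>2, rule_format])
    show "\<forall>l m i. length l = p \<and> length m = q \<and> i < q \<longrightarrow> linear (\<lambda>\<phi>. c * \<alpha> l (m[i := \<phi>]))"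
      by (intro allI impI lin) (rule conjunct1[OF \<alpha>3, rule_format])
    show "\<forall>l m i j. length l = p \<and> length m = q \<and> i < j \<and> j < p \<and> l ! i = l ! j \<longrightarrow>
        c * \<alpha> l m = 0"
      unfolding mult_eq_0_iff by (intro allI impI disjI2) (rule conjunct1[OF \<alpha>4, rule_format])
    show "\<forall>l m m'. mset m = mset m' \<longrightarrow> c * \<alpha> l m = c * \<alpha> l m'"
      by (intro allI impI arg_cong[where f = "(*) c"]) (rule conjunct2[OF \<alpha>4, rule_format])
  qed
qed

lemma bitensor_Ad_scaleR: "bitensor_Ad D a (c *\<^sub>R \<alpha>) = c *\<^sub>R bitensor_Ad D a \<alpha>"
  by (simp add: bitensor_Ad_def scaleR_fun_def)

lemma B_fibre_scaleR:
  assumes "\<xi> \<in> B_fibre D p q x"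
  shows "c *\<^sub>R \<xi> \<in> B_fibre D p q x"
proof -
  have "(c *\<^sub>R \<xi>) r = c *\<^sub>R \<xi> r" for r by (simp add: scaleR_fun_def)
  then show ?thesis
    using assms by (auto simp: B_fibre_def bitensor_Ad_scaleR intro: bitensors_scaleR)
qed

text \<open>Smoothness is tested by evaluating on coordinate fields and fixed covectors. This gives
  real functions on the part of \<open>P\<close> over a chart, which is open because the projection
  is continuous, and evaluation commutes with the constant.\<close>

lemma B_smooth_scaleR:
  assumes "gauge_setting D" "B_smooth D u"
  shows "B_smooth D (\<lambda>x. c *\<^sub>R u x)"
  unfolding B_smooth_def
proof (intro ballI allI)
  fix d l m assume d: "d \<in> M_atlas D"
  have "open (fst d)"
    using assms(1) d by (auto simp: gauge_setting_def smooth_atlas_def is_chart_def)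
  moreover have "continuous_on UNIV (P_proj D)" and P: "smooth_atlas (P_atlas D)"
    using assms(1) by (auto simp: gauge_setting_def principal_bundle_def smooth_map_on_def)
  ultimately have "open (P_proj D -` fst d)"
    by (simp add: open_vimage)
  then show "smooth_map_on (P_proj D -` fst d) (P_atlas D) std_atlas
      (\<lambda>r. (c *\<^sub>R u (P_proj D r)) r (map (coord_vec (M_atlas D) d (P_proj D r)) l) m)"
    unfolding scaleR_fun_def
    by (rule smooth_map_on_scaleR[OF P]) (use assms(2) d in \<open>simp add: B_smooth_def\<close>)
qed

section \<open>Operators that are diagonal in the bigrading\<close>

text \<open>Common form of \<open>T\<close> and \<open>S_s\<close>, acting on sections; the
  coefficient depends on the symmetric degree q alone.\<close>

definition deg_scale ::
    "(nat \<Rightarrow> real) \<Rightarrow> ('m \<Rightarrow> ('p, 'n::finite, 'k::finite) S_elem) \<Rightarrow> 'm \<Rightarrow> ('p, 'n, 'k) S_elem"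
  where "deg_scale c u = (\<lambda>x p q. c q *\<^sub>R u x p q)"

lemma T_aut_eq_deg_scale: "(\<lambda>u x. T_aut (u x)) = deg_scale (\<lambda>q. (-1) ^ q)"
  by (intro ext) (simp add: deg_scale_def T_aut_def)

lemma S_aut_eq_deg_scale: "(\<lambda>u x. S_aut s (u x)) = deg_scale (\<lambda>q. s ^ q)"
  by (intro ext) (simp add: deg_scale_def S_aut_def)

lemma deg_scale_inverse:
  assumes "\<And>q. c q * d q = 1"
  shows "deg_scale c (deg_scale d u) = u"
  using assms by (simp add: deg_scale_def)

lemma deg_scale_in_S_sections:
  assumes "gauge_setting D" "u \<in> S_sections D n"
  shows "deg_scale c u \<in> S_sections D n"
proof -
  have "deg_scale c u x \<in> S_fibre D n x" for x
    using assms(2) by (auto simp: S_sections_def S_fibre_def deg_scale_def B_fibre_scaleR)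
  moreover have "B_smooth D (\<lambda>x. deg_scale c u x p q)" for p q
    using assms(2) by (auto simp: S_sections_def deg_scale_def intro: B_smooth_scaleR[OF assms(1)])
  ultimately show ?thesis by (simp add: S_sections_def)
qed

lemma linear_bij_on_deg_scale:
  assumes "gauge_setting D" and c: "\<And>q. c q \<noteq> 0"
  shows "linear_bij_on (S_sections D n) (deg_scale c)"
proof -
  have "bij_betw (deg_scale c) (S_sections D n) (S_sections D n)"
    by (rule bij_betw_byWitness[where f' = "deg_scale (\<lambda>q. inverse (c q))"])
      (auto simp: deg_scale_inverse c deg_scale_in_S_sections[OF assms(1)])
  moreover have "deg_scale c (a *\<^sub>R u + b *\<^sub>R v) = a *\<^sub>R deg_scale c u + b *\<^sub>R deg_scale c v"
    for a b and u v :: "'a \<Rightarrow> ('c, 'd, 'e) S_elem"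
    by (intro ext) (simp add: deg_scale_def scaleR_fun_def algebra_simps)
  ultimately show ?thesis by (simp add: linear_bij_on_def)
qed

section \<open>Diagonal operators and the weighted pairings\<close>

lemma B_inner_scaleR: "B_inner D p q x (a *\<^sub>R \<xi>) (b *\<^sub>R \<eta>) = a * b * B_inner D p q x \<xi> \<eta>"
  by (simp add: B_inner_def Let_def scaleR_fun_def sum_distrib_left mult_ac)

lemma B_inner_nonneg: "0 \<le> B_inner D p q x \<xi> \<xi>"
  by (simp add: B_inner_def Let_def sum_nonneg)

lemma B_norm_sq: "(B_norm D p q x \<xi>)\<^sup>2 = B_inner D p q x \<xi> \<xi>"
  by (simp add: B_norm_def B_inner_nonneg)

lemma weighted_pairing_deg_scale:
  "weighted_pairing D wt n (deg_scale c u) (deg_scale d v) =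
    (\<Sum>(p, q) | p + q = n. c q * d q *
      (\<integral>x. wt x * B_inner D p q x (u x p q) (v x p q) \<partial>riemannian_measure (M_atlas D) (M_metric D)))"
  unfolding weighted_pairing_def
proof (intro sum.cong refl, clarify)
  fix p q
  have "wt x * B_inner D p q x (deg_scale c u x p q) (deg_scale d v x p q) =
      (c q * d q) * (wt x * B_inner D p q x (u x p q) (v x p q))" for x
    by (simp add: deg_scale_def B_inner_scaleR)
  then show "(\<integral>x. wt x * B_inner D p q x (deg_scale c u x p q) (deg_scale d v x p q)
        \<partial>riemannian_measure (M_atlas D) (M_metric D)) =
      c q * d q * (\<integral>x. wt x * B_inner D p q x (u x p q) (v x p q)
        \<partial>riemannian_measure (M_atlas D) (M_metric D))"
    \<comment> \<open>A constant factor leaves the integral for every integrand: a non-integrable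
      function has integral 0, and a nonzero factor does not change integrability.\<close>
    by (simp only: integral_mult_right_zero)
qed

lemma weighted_pairing_nonneg:
  assumes "\<And>x. 0 \<le> wt x"
  shows "0 \<le> weighted_pairing D wt n u u"
  unfolding weighted_pairing_def
  using assms by (intro sum_nonneg) (auto intro!: integral_nonneg_AE mult_nonneg_nonneg B_inner_nonneg)

text \<open>The squared norm is a sum of nonnegative integrals, and the one in bidegree (p,q) is
  multiplied by \<open>(c q)^2\<close>. Only q \<le> n occurs when p + q = n.\<close>

lemma pnorm_deg_scale_le:
  assumes wt: "\<And>x. 0 \<le> wt x" and C: "\<And>q. q \<le> n \<Longrightarrow> \<bar>c q\<bar> \<le> C"
  shows "pnorm (weighted_pairing D wt n) (deg_scale c u) \<le> C * pnorm (weighted_pairing D wt n) u"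
proof -
  let ?I = "\<lambda>p q. \<integral>x. wt x * B_inner D p q x (u x p q) (u x p q)
    \<partial>riemannian_measure (M_atlas D) (M_metric D)"
  have C0: "0 \<le> C" using C[of 0] by simp
  have "weighted_pairing D wt n (deg_scale c u) (deg_scale c u) \<le> (\<Sum>(p, q) | p + q = n. C\<^sup>2 * ?I p q)"
    unfolding weighted_pairing_deg_scale
  proof (rule sum_mono, clarify)
    fix p q assume "n = p + q"
    then have "\<bar>c q\<bar> \<le> \<bar>C\<bar>" using C[of q] C0 by simp
    then have "c q * c q \<le> C\<^sup>2"
      unfolding abs_le_square_iff power2_eq_square by simp
    moreover have "0 \<le> ?I p q"
      by (intro integral_nonneg_AE) (simp add: wt B_inner_nonneg)
    ultimately show "c q * c q * ?I p q \<le> C\<^sup>2 * ?I p q" by (rule mult_right_mono)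
  qed
  also have "\<dots> = C\<^sup>2 * weighted_pairing D wt n u u"
    by (simp add: weighted_pairing_def sum_distrib_left case_prod_unfold)
  finally have "pnorm (weighted_pairing D wt n) (deg_scale c u) \<le>
      sqrt (C\<^sup>2 * weighted_pairing D wt n u u)"
    by (simp add: pnorm_def)
  then show ?thesis using C0 by (simp add: pnorm_def real_sqrt_mult)
qed

lemma unitary_on_deg_scale:
  assumes "gauge_setting D" and c: "\<And>q. c q * c q = 1"
  shows "unitary_on (S_sections D n) (weighted_pairing D wt n) (deg_scale c)"
proof -
  have "c q \<noteq> 0" for q using c[of q] by auto
  then have "linear_bij_on (S_sections D n) (deg_scale c)"
    by (rule linear_bij_on_deg_scale[OF assms(1)])
  moreover have "weighted_pairing D wt n (deg_scale c u) (deg_scale c v) = weighted_pairing D wt n u v"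
    for u v
    unfolding weighted_pairing_deg_scale c by (simp add: weighted_pairing_def)
  ultimately show ?thesis by (simp add: unitary_on_def)
qed

text \<open>The inverse is again diagonal, with reciprocal coefficients, so one estimate bounds both
  the operator and its inverse.\<close>

lemma bounded_invertible_on_deg_scale:
  assumes "gauge_setting D" and wt: "\<And>x. 0 \<le> wt x" and c: "\<And>q. c q \<noteq> 0"
  shows "bounded_invertible_on (S_sections D n) (weighted_pairing D wt n) (deg_scale c)"
proof -
  let ?V = "S_sections D n" and ?d = "\<lambda>q. inverse (c q)"
  have lb: "linear_bij_on ?V (deg_scale c)"
    by (rule linear_bij_on_deg_scale[OF assms(1) c])
  have inv: "inv_into ?V (deg_scale c) u = deg_scale ?d u" if "u \<in> ?V" for u
  proof (rule inv_into_f_eq)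
    show "inj_on (deg_scale c) ?V" using lb by (simp add: linear_bij_on_def bij_betw_def)
    show "deg_scale ?d u \<in> ?V" by (rule deg_scale_in_S_sections[OF assms(1) that])
    show "deg_scale c (deg_scale ?d u) = u" by (rule deg_scale_inverse) (simp add: c)
  qed
  have bound: "\<exists>C. \<forall>u. pnorm (weighted_pairing D wt n) (deg_scale b u) \<le>
      C * pnorm (weighted_pairing D wt n) u" for b
    \<comment> \<open>A maximum over the finitely many degrees up to n; over all q the coefficients,
      such as \<open>s^q\<close>, may be unbounded.\<close>
    by (intro exI[of _ "Max ((\<lambda>q. \<bar>b q\<bar>) ` {..n})"] allI pnorm_deg_scale_le wt) simp
  show ?thesis
    unfolding bounded_invertible_on_def
    using lb bound[of c] bound[of ?d] by (auto simp: inv)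
qed

lemma pnorm_deg_scale_sq:
  assumes "\<And>x. 0 \<le> wt x"
  shows "(pnorm (weighted_pairing D wt n) (deg_scale c u))\<^sup>2 =
    (\<Sum>(p, q) | p + q = n. \<integral>x. (c q)\<^sup>2 * wt x * (B_norm D p q x (u x p q))\<^sup>2
      \<partial>riemannian_measure (M_atlas D) (M_metric D))"
proof -
  have "(pnorm (weighted_pairing D wt n) (deg_scale c u))\<^sup>2 =
      weighted_pairing D wt n (deg_scale c u) (deg_scale c u)"
    by (simp add: pnorm_def weighted_pairing_nonneg assms)
  then show ?thesis
    unfolding weighted_pairing_deg_scale B_norm_sq
    by (simp add: power2_eq_square mult.assoc)
qed

section \<open>Changing the sign of \<lambda>\<close>

lemma flip_lam_simps [simp]:
  "M_atlas (flip_lam D) = M_atlas D" "M_metric (flip_lam D) = M_metric D"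
  "G_group (flip_lam D) = G_group D" "G_atlas (flip_lam D) = G_atlas D"
  "P_atlas (flip_lam D) = P_atlas D" "P_proj (flip_lam D) = P_proj D"
  "P_act (flip_lam D) = P_act D" "P_conn (flip_lam D) = P_conn D"
  "P_lam (flip_lam D) = - P_lam D"
  by (simp_all add: flip_lam_def)

lemma S_sections_flip_lam: "S_sections (flip_lam D) n = S_sections D n"
  by (simp add: S_sections_def S_fibre_def B_fibre_def B_smooth_def bitensor_Ad_def)

lemma B_inner_flip_lam: "B_inner (flip_lam D) = B_inner D"
proof -
  have "lie_inner (flip_lam D) = lie_inner D"
    by (simp add: lie_inner_def fun_eq_iff)
  then show ?thesis unfolding B_inner_def by (simp only: flip_lam_simps)
qed

text \<open>The section \<open>lam_B\<close> is linear in \<lambda>, so the flip multiplies it by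
  -1, and the squared norm by \<open>(-1) * (-1) = 1\<close>.\<close>

lemma weight_A_flip_lam: "weight_A (flip_lam D) = weight_A D"
proof -
  have "lam_B (flip_lam D) x = (-1) *\<^sub>R lam_B D x" for x
    by (intro ext) (simp add: lam_B_def ad_form_def scaleR_fun_def blinfun.minus_right)
  then show ?thesis
    unfolding weight_A_def B_norm_sq B_inner_flip_lam by (simp only: B_inner_scaleR) simp
qed

lemma weight_B_flip_lam: "weight_B (flip_lam D) = weight_B D"
proof -
  have "curvature (flip_lam D) = curvature D"
    by (simp add: curvature_def curvature_on_P_def conn_ext_deriv_def horizontal_lift_def fun_eq_iff)
  then show ?thesis
    by (intro ext) (simp only: weight_B_def B_norm_sq B_inner_flip_lam)
qed

lemma weighted_pairing_flip_lam: "weighted_pairing (flip_lam D) = weighted_pairing D"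
  by (intro ext) (simp only: weighted_pairing_def B_inner_flip_lam flip_lam_simps)

theorem proposition3p4:
  fixes D :: "('m::{t2_space,second_countable_topology}, 'g::{t2_space,second_countable_topology},
               'p::{t2_space,second_countable_topology}, 'n::finite, 'k::finite) gauge_data"
    and n :: nat
  assumes "gauge_setting D"
  shows
    "(\<forall>wt \<in> {weight_A D, weight_B D}.
        let V = S_sections D n; ip = weighted_pairing D wt n in
        unitary_on V ip (\<lambda>u x. T_aut (u x)) \<and>
        (\<forall>s>0. bounded_invertible_on V ip (\<lambda>u x. S_aut s (u x)) \<and>
           (\<forall>u\<in>V. (pnorm ip (\<lambda>x. S_aut s (u x)))\<^sup>2 =
              (\<Sum>(p, q) | p + q = n.
                 \<integral>x. s ^ (2 * q) * wt x * (B_norm D p q x (u x p q))\<^sup>2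
                   \<partial>riemannian_measure (M_atlas D) (M_metric D))))) \<and>
     hilbert_completion (S_sections D n) (pairing_A D n) =
       hilbert_completion (S_sections (flip_lam D) n) (pairing_A (flip_lam D) n) \<and>
     hilbert_completion (S_sections D n) (pairing_B D n) =
       hilbert_completion (S_sections (flip_lam D) n) (pairing_B (flip_lam D) n)"
proof -
  have weights: "0 \<le> wt x" if "wt \<in> {weight_A D, weight_B D}" for wt x
    using that by (auto simp: weight_A_def weight_B_def)
  have "bounded_invertible_on (S_sections D n) (weighted_pairing D wt n) (deg_scale (\<lambda>q. s ^ q))"
    if "wt \<in> {weight_A D, weight_B D}" "s > 0" for wt s
    by (rule bounded_invertible_on_deg_scale[OF assms weights[OF that(1)]]) (use that in simp)
  moreover have "unitary_on (S_sections D n) (weighted_pairing D wt n) (deg_scale (\<lambda>q. (-1) ^ q))" for wt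
    \<comment> \<open>\<open>(-1)^q * (-1)^q\<close> is collected into
      \<open>((-1) * (-1))^q = 1\<close>.\<close>
    by (rule unitary_on_deg_scale[OF assms]) (simp flip: power_mult_distrib)
  moreover have "(pnorm (weighted_pairing D wt n) (\<lambda>x. S_aut s (u x)))\<^sup>2 =
      (\<Sum>(p, q) | p + q = n. \<integral>x. s ^ (2 * q) * wt x * (B_norm D p q x (u x p q))\<^sup>2
        \<partial>riemannian_measure (M_atlas D) (M_metric D))"
    if "wt \<in> {weight_A D, weight_B D}" for wt s u
  proof -
    have "(\<lambda>x. S_aut s (u x)) = deg_scale (\<lambda>q. s ^ q) u"
      by (rule fun_cong[OF S_aut_eq_deg_scale])
    then show ?thesis
      using pnorm_deg_scale_sq[of wt D n "\<lambda>q. s ^ q" u] weights[OF that]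
      by (simp add: mult.commute[of 2] flip: power_mult)
  qed
  \<comment> \<open>After these rewrites the two sides of each equation between completions are the
    same term.\<close>
  ultimately show ?thesis
    unfolding Let_def T_aut_eq_deg_scale S_aut_eq_deg_scale pairing_A_def pairing_B_def
      S_sections_flip_lam weight_A_flip_lam weight_B_flip_lam weighted_pairing_flip_lam
    by blast
qed

end
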